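(* Let $v$ and $q$ be positive integers, $v$ not a square. Let $m,n$ be integers with $(m,q)=(n,q)=1$, and let $x=m/q+\sqrt v$, $y=n/q+\sqrt v$. Let $q_1'=(m+n,q)$. Then $x$ and $y$ have inverse periods if, and only if, there is a pair $(r,c)\in\mathbb{Z}^2$ such that $r^2-c^2v=\pm 1$ (i.e. $r^2-c^2v\in\{1,-1\}$) and $(c,q^2)=qq_1'$.
   Context: $(a,b)$ denotes the (positive) greatest common divisor of the integers $a,b$; in particular $(0,b)=|b|$. Two real quadratic irrationals $x,y$ are said to have inverse periods if their regular continued fraction expansions can be written as $x=[a_0,\ldots,a_{j-1},[b_1,\ldots,b_k]]$ and $y=[c_0,\ldots,c_{l-1},[b_k,b_{k-1},\ldots,b_1]]$, where the inner bracket is the period, repeated indefinitely, and the pre-periods $a_0,\ldots,a_{j-1}$ and $c_0,\ldots,c_{l-1}$ may be empty. *)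

theory Defs
  imports Complex_Main
begin

definition quadratic_irrational :: "real \<Rightarrow> bool" where
  "quadratic_irrational x \<longleftrightarrow>
     x \<notin> \<rat> \<and>
     (\<exists>a b c :: int. a \<noteq> 0 \<and> of_int a * x\<^sup>2 + of_int b * x + of_int c = 0)"

text \<open>
  For irrational \<open>x\<close> the denominator below never vanishes, and \<open>cf_coeff x\<close>
  is the sequence of partial quotients of the (unique) regular continued fraction
  expansion of \<open>x\<close>. For rational \<open>x\<close> the values are eventually
  0, by the convention \<open>1 / 0 = 0\<close>, and carry no meaning.
\<close>

primrec cf_complete_quotient :: "real \<Rightarrow> nat \<Rightarrow> real" where
  "cf_complete_quotient x 0 = x"
| "cf_complete_quotient x (Suc i) =
     1 / (cf_complete_quotient x i - of_int \<lfloor>cf_complete_quotient x i\<rfloor>)"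

definition cf_coeff :: "real \<Rightarrow> nat \<Rightarrow> int" where
  "cf_coeff x i = \<lfloor>cf_complete_quotient x i\<rfloor>"

text \<open>
  \<open>has_cf_period x bs\<close> says that \<open>x\<close> can be written as
  \<open>[a\<^sub>0, \<dots>, a\<^bsub>j-1\<^esub>, [bs]]\<close> with the block \<open>bs\<close> repeated indefinitely; the pre-period may
  be empty (\<open>j = 0\<close>), and \<open>bs\<close> is not required to be a shortest period.
\<close>

definition has_cf_period :: "real \<Rightarrow> int list \<Rightarrow> bool" where
  "has_cf_period x bs \<longleftrightarrow>
     bs \<noteq> [] \<and> (\<exists>j. \<forall>i. cf_coeff x (j + i) = bs ! (i mod length bs))"

definition inverse_periods :: "real \<Rightarrow> real \<Rightarrow> bool" where
  "inverse_periods x y \<longleftrightarrow>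
     quadratic_irrational x \<and> quadratic_irrational y \<and>
     (\<exists>bs. has_cf_period x bs \<and> has_cf_period y (rev bs))"

end

theory Submission
  imports Defs "HOL-Number_Theory.Cong"
begin

text \<open>
  Write \<open>x'\<close> for the conjugate of \<open>x\<close>. The proof has two independent halves.

  Continued fractions turn the condition on periods into a condition on \<open>GL(2, \<int>)\<close>:
  \<open>x\<close> and \<open>y\<close> have inverse periods iff \<open>y\<close> is the image of \<open>-x'\<close> under an integral fractional linear
  map of determinant 1 or -1 (\<open>inverse_periods_iff_gl2_equiv\<close>). Three classical theorems give this.
  Lagrange's theorem: the expansion of \<open>x\<close> is periodic, as its complete quotients eventually lie
  in the finite set of reduced numbers of a fixed discriminant. Galois' theorem: for a reduced
  complete quotient \<open>X\<close> within the periodic part the number \<open>-1 / X'\<close> has the reversed period, because conjugating the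
  expansion algorithm makes it run backwards. Serret's theorem: two irrationals have the same tail
  iff they are equivalent under \<open>GL(2, \<int>)\<close>, so that \<open>-1 / X'\<close> may be replaced by \<open>-x'\<close>, and the numbers
  with the reversed period are exactly those equivalent to it.

  Arithmetic then treats the case \<open>-x' = -m/q + \<surd>v\<close>, \<open>y = n/q + \<surd>v\<close>. The matrices mapping one to
  the other correspond to the solutions of \<open>r\<^sup>2 - c\<^sup>2 v = \<plusminus>1\<close> with \<open>c = q e\<close> and
  \<open>r (m + n) + e m n \<equiv> 0\<close> modulo \<open>q\<close> (\<open>gl2_equiv_shifted_sqrt_iff\<close>). The congruence forces
  \<open>gcd e q = gcd (m + n) q\<close>. Conversely, if these divisors agree, the congruence may still fail, but it
  holds after passing to a suitable power of the unit \<open>r + c \<surd>v\<close> (\<open>Pell_congruence_iff\<close>).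
\<close>

section \<open>Complete quotients determine, and are determined by, the partial quotients\<close>

abbreviation cq :: "real \<Rightarrow> nat \<Rightarrow> real" where
  "cq \<equiv> cf_complete_quotient"

lemma irrational_recip_shift:
  assumes "x \<notin> \<rat>"
  shows "1 / (x - of_int a) \<notin> \<rat>"
proof
  assume "1 / (x - of_int a) \<in> \<rat>"
  then have "inverse (1 / (x - of_int a)) + of_int a \<in> \<rat>"
    by (intro Rats_add Rats_inverse Rats_of_int)
  then show False
    using assms by simp
qed

lemma cq_irrational: "x \<notin> \<rat> \<Longrightarrow> cq x i \<notin> \<rat>"
  by (induction i) (simp_all add: irrational_recip_shift)

lemma cq_cq: "cq (cq x i) j = cq x (i + j)"
  by (induction j) simp_all

lemma cf_coeff_cq: "cf_coeff (cq x i) j = cf_coeff x (i + j)"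
  by (simp add: cf_coeff_def cq_cq)

lemma irrational_frac_bounds:
  assumes "x \<notin> \<rat>"
  shows "0 < x - of_int \<lfloor>x\<rfloor>" "x - of_int \<lfloor>x\<rfloor> < 1"
proof -
  have "x \<noteq> of_int \<lfloor>x\<rfloor>"
    using assms Rats_of_int by metis
  then show "0 < x - of_int \<lfloor>x\<rfloor>" "x - of_int \<lfloor>x\<rfloor> < 1"
    by linarith+
qed

lemma cq_Suc_gt_1: "x \<notin> \<rat> \<Longrightarrow> cq x (Suc i) > 1"
  using irrational_frac_bounds[OF cq_irrational, of x i] by simp

lemma cq_expand: "x \<notin> \<rat> \<Longrightarrow> cq x i = of_int (cf_coeff x i) + 1 / cq x (Suc i)"
  by (simp add: cf_coeff_def)

text \<open>Two consecutive complete quotients have product at least 2, so inverting twice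
  shrinks distances by a factor of 4: this is what makes the expansion converge.\<close>

lemma cf_coeff_eq_imp_close:
  assumes "x \<notin> \<rat>" "y \<notin> \<rat>" "\<And>i. cf_coeff x i = cf_coeff y i"
  shows "\<bar>x - y\<bar> \<le> (1/4) ^ k"
  using assms
proof (induction k arbitrary: x y)
  case 0
  have "\<lfloor>x\<rfloor> = \<lfloor>y\<rfloor>"
    using "0.prems"(3)[of 0] by (simp add: cf_coeff_def)
  then show ?case
    using irrational_frac_bounds[OF "0.prems"(1)] irrational_frac_bounds[OF "0.prems"(2)]
    by (simp; linarith)
next
  case (Suc k)
  define x1 x2 y1 y2 where defs: "x1 = cq x 1" "x2 = cq x 2" "y1 = cq y 1" "y2 = cq y 2"
  define a b where "a = real_of_int (cf_coeff x 0)" and "b = real_of_int (cf_coeff x 1)"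
  have ab': "a = real_of_int (cf_coeff y 0)" "b = real_of_int (cf_coeff y 1)"
    using Suc.prems(3) by (simp_all add: a_def b_def)
  have gt: "x1 > 1" "x2 > 1" "y1 > 1" "y2 > 1"
    using cq_Suc_gt_1[OF Suc.prems(1)] cq_Suc_gt_1[OF Suc.prems(2)]
    by (auto simp: defs numeral_2_eq_2 simp del: cf_complete_quotient.simps)
  have x: "x = a + 1 / x1" "x1 = b + 1 / x2"
    using cq_expand[OF Suc.prems(1), of 0] cq_expand[OF Suc.prems(1), of 1]
    by (simp_all add: defs a_def b_def numeral_2_eq_2)
  have y: "y = a + 1 / y1" "y1 = b + 1 / y2"
    using cq_expand[OF Suc.prems(2), of 0] cq_expand[OF Suc.prems(2), of 1]
    by (simp_all add: defs ab' numeral_2_eq_2)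
  have "b \<ge> 1"
    using gt(1) by (simp add: b_def cf_coeff_def defs le_floor_iff)
  then have "b * x2 \<ge> 1" "b * y2 \<ge> 1"
    using gt mult_mono[of 1 b 1 x2] mult_mono[of 1 b 1 y2] by auto
  moreover have "x1 * x2 = b * x2 + 1" "y1 * y2 = b * y2 + 1"
    using gt x(2) y(2) by (simp_all add: field_simps)
  ultimately have prod: "x1 * x2 \<ge> 2" "y1 * y2 \<ge> 2"
    by linarith+
  have "x - y = (y1 - x1) / (x1 * y1)"
    using gt by (simp add: x(1) y(1) field_simps)
  also have "y1 - x1 = (x2 - y2) / (x2 * y2)"
    using gt by (simp add: x(2) y(2) field_simps)
  finally have "x - y = (x2 - y2) / ((x1 * x2) * (y1 * y2))"
    by (simp add: field_simps)
  moreover have "(x1 * x2) * (y1 * y2) > 0"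
    using gt by simp
  ultimately have "\<bar>x - y\<bar> = \<bar>x2 - y2\<bar> / ((x1 * x2) * (y1 * y2))"
    by (metis abs_divide abs_of_pos)
  also have "\<dots> \<le> \<bar>x2 - y2\<bar> / 4"
    using prod mult_mono[OF prod] by (intro divide_left_mono) auto
  also have "\<bar>x2 - y2\<bar> \<le> (1/4) ^ k"
    unfolding defs using Suc.prems
    by (intro Suc.IH) (simp_all add: cf_coeff_cq cq_irrational)
  finally show ?case
    by simp
qed

lemma cf_coeff_inject:
  assumes "x \<notin> \<rat>" "y \<notin> \<rat>" "\<And>i. cf_coeff x i = cf_coeff y i"
  shows "x = y"
proof (rule ccontr)
  assume "x \<noteq> y"
  then obtain k where "(1/4) ^ k < \<bar>x - y\<bar>"
    using real_arch_pow_inv[of "\<bar>x - y\<bar>" "1/4"] by auto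
  then show False
    using cf_coeff_eq_imp_close[OF assms, of k] by simp
qed

section \<open>Eventual agreement of expansions\<close>

definition tail_equiv :: "real \<Rightarrow> real \<Rightarrow> bool" where
  "tail_equiv x y \<longleftrightarrow> (\<exists>i j. cq x i = cq y j)"

lemma tail_equiv_refl: "tail_equiv x x"
  by (auto simp: tail_equiv_def)

lemma tail_equiv_sym: "tail_equiv x y \<Longrightarrow> tail_equiv y x"
  unfolding tail_equiv_def by metis

lemma tail_equiv_trans [trans]:
  assumes "tail_equiv x y" "tail_equiv y z"
  shows "tail_equiv x z"
proof -
  obtain i j k l where eq: "cq x i = cq y j" "cq y k = cq z l"
    using assms by (auto simp: tail_equiv_def)
  have "cq x (i + k) = cq y (j + k)"
    using eq(1) by (metis cq_cq)
  also have "\<dots> = cq z (l + j)"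
    using eq(2) by (metis cq_cq add.commute)
  finally show ?thesis
    by (auto simp: tail_equiv_def)
qed

lemma tail_equiv_shift: "tail_equiv x (x + of_int a)"
proof -
  have "cq x 1 = cq (x + of_int a) 1"
    by simp
  then show ?thesis
    unfolding tail_equiv_def by blast
qed

lemma tail_equiv_inverse_pos:
  assumes "x > 0"
  shows "tail_equiv x (1 / x)"
proof -
  have *: "tail_equiv x (1 / x)" if "0 < x" "x < 1" for x
  proof -
    have "\<lfloor>x\<rfloor> = 0"
      using that by linarith
    then have "cq x 1 = cq (1 / x) 0"
      by simp
    then show ?thesis
      unfolding tail_equiv_def by blast
  qed
  consider "x < 1" | "x = 1" | "x > 1"
    by linarith
  then show ?thesis
  proof cases
    case 3
    then show ?thesis
      using *[of "1 / x"] by (simp add: tail_equiv_sym)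
  qed (use * assms tail_equiv_refl in auto)
qed

text \<open>Negation reduces to \<open>x \<mapsto> 1 - x\<close> on the unit interval. There, both \<open>x\<close> and \<open>1 - x\<close>
  reach \<open>1 / x - 1\<close> by integer shifts and inversions of positive numbers.\<close>

lemma tail_equiv_uminus: "tail_equiv x (- x)"
proof -
  have reflect: "tail_equiv t (1 - t)" if "0 < t" "t < 1" for t
  proof -
    have "tail_equiv t (1 / t)"
      by (rule tail_equiv_inverse_pos) fact
    also have "tail_equiv (1 / t) (1 / t - 1)"
      using tail_equiv_shift[of "1 / t" "-1"] by simp
    also have "tail_equiv (1 / t - 1) (1 / (1 / t - 1))"
      by (rule tail_equiv_inverse_pos) (use that in simp)
    also have "tail_equiv (1 / (1 / t - 1)) (1 / (1 / t - 1) + 1)"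
      using tail_equiv_shift[of _ 1] by simp
    also have "1 / (1 / t - 1) + 1 = 1 / (1 - t)"
      using that by (simp add: field_simps)
    also have "tail_equiv (1 / (1 - t)) (1 - t)"
      using tail_equiv_inverse_pos[of "1 / (1 - t)"] that by simp
    finally show ?thesis .
  qed
  define t where "t = x - of_int \<lfloor>x\<rfloor>"
  have t: "0 \<le> t" "t < 1"
    unfolding t_def by linarith+
  have xt: "tail_equiv x t"
    using tail_equiv_shift[of x "- \<lfloor>x\<rfloor>"] by (simp add: t_def)
  show ?thesis
  proof (cases "t = 0")
    case True
    then have "- x = x + of_int (- 2 * \<lfloor>x\<rfloor>)"
      by (simp add: t_def)
    then show ?thesis
      using tail_equiv_shift by metis
  next
    case False
    note xt
    also have "tail_equiv t (1 - t)"
      using reflect t False by simp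
    also have "tail_equiv (1 - t) (1 - t + of_int (- 1 - \<lfloor>x\<rfloor>))"
      by (rule tail_equiv_shift)
    also have "1 - t + of_int (- 1 - \<lfloor>x\<rfloor>) = - x"
      by (simp add: t_def)
    finally show ?thesis .
  qed
qed

lemma tail_equiv_inverse: "tail_equiv x (1 / x)"
proof -
  consider "x > 0" | "x = 0" | "- x > 0"
    by linarith
  then show ?thesis
  proof cases
    case 3
    have "tail_equiv x (- x)"
      by (rule tail_equiv_uminus)
    also have "tail_equiv (- x) (1 / - x)"
      by (rule tail_equiv_inverse_pos) fact
    also have "tail_equiv (1 / - x) (1 / x)"
      using tail_equiv_uminus[of "1 / - x"] by simp
    finally show ?thesis .
  qed (simp_all add: tail_equiv_inverse_pos tail_equiv_refl)
qed

lemma has_cf_period_imp_tail_equiv: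
  assumes "x \<notin> \<rat>" "y \<notin> \<rat>" "has_cf_period x bs" "has_cf_period y bs"
  shows "tail_equiv x y"
proof -
  obtain i j where
    "\<And>t. cf_coeff x (i + t) = bs ! (t mod length bs)"
    "\<And>t. cf_coeff y (j + t) = bs ! (t mod length bs)"
    using assms(3,4) by (auto simp: has_cf_period_def)
  then have "cq x i = cq y j"
    using assms(1,2) by (intro cf_coeff_inject) (simp_all add: cq_irrational cf_coeff_cq)
  then show ?thesis
    by (auto simp: tail_equiv_def)
qed

text \<open>The same block \<open>bs\<close> serves for \<open>y\<close>, without a cyclic rotation, since the offset at which the periodic
  part starts can be chosen freely.\<close>

lemma has_cf_period_tail_equiv:
  assumes "tail_equiv x y" "has_cf_period x bs"
  shows "has_cf_period y bs"
proof -
  obtain i j where ij: "cq x i = cq y j"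
    using assms(1) by (auto simp: tail_equiv_def)
  obtain p where bs: "bs \<noteq> []" and p: "\<And>t. cf_coeff x (p + t) = bs ! (t mod length bs)"
    using assms(2) by (auto simp: has_cf_period_def)
  \<comment> \<open>Skipping \<open>i\<close> whole periods of \<open>x\<close> passes the index \<open>i\<close> at which \<open>y\<close> joins.\<close>
  define M where "M = i * length bs"
  have "M \<ge> i"
    using bs by (cases bs) (auto simp: M_def)
  have "cf_coeff y (j + (p + M - i) + t) = bs ! (t mod length bs)" for t
  proof -
    have "cf_coeff y (j + (p + M - i) + t) = cf_coeff (cq x i) (p + M - i + t)"
      by (simp add: ij cf_coeff_cq add.assoc)
    also have "\<dots> = cf_coeff x (p + (M + t))"
      using \<open>M \<ge> i\<close> by (simp add: cf_coeff_cq add.assoc)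
    also have "\<dots> = bs ! (t mod length bs)"
      by (simp only: p) (simp add: M_def)
    finally show ?thesis .
  qed
  then show ?thesis
    using bs by (auto simp: has_cf_period_def)
qed

section \<open>Serret's theorem\<close>

text \<open>The equation is kept free of denominators: composition and inversion of matrices then
  need no side conditions.\<close>

definition gl2_equiv :: "real \<Rightarrow> real \<Rightarrow> bool" where
  "gl2_equiv x y \<longleftrightarrow>
     (\<exists>a b c d :: int. (a * d - b * c = 1 \<or> a * d - b * c = -1) \<and>
        y * (of_int c * x + of_int d) = of_int a * x + of_int b)"

lemma gl2_equivI:
  fixes a b c d :: int
  assumes "a * d - b * c = 1 \<or> a * d - b * c = -1"
    and "y * (of_int c * x + of_int d) = of_int a * x + of_int b"
  shows "gl2_equiv x y"
  using assms unfolding gl2_equiv_def by blast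

lemma gl2_equiv_refl: "gl2_equiv x x"
  by (rule gl2_equivI[of 1 1 0 0]) auto

lemma gl2_equiv_sym:
  assumes "gl2_equiv x y"
  shows "gl2_equiv y x"
proof -
  obtain a b c d :: int where *: "a * d - b * c = 1 \<or> a * d - b * c = -1"
    "y * (of_int c * x + of_int d) = of_int a * x + of_int b"
    using assms unfolding gl2_equiv_def by blast
  show ?thesis
    by (rule gl2_equivI[of "-d" "-a" b c]) (use * in \<open>auto simp: algebra_simps\<close>)
qed

lemma gl2_equiv_trans [trans]:
  assumes "gl2_equiv x y" "gl2_equiv y z"
  shows "gl2_equiv x z"
proof -
  obtain a b c d :: int where 1: "a * d - b * c = 1 \<or> a * d - b * c = -1"
    "y * (of_int c * x + of_int d) = of_int a * x + of_int b"
    using assms unfolding gl2_equiv_def by blast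
  obtain e f g h :: int where 2: "e * h - f * g = 1 \<or> e * h - f * g = -1"
    "z * (of_int g * y + of_int h) = of_int e * y + of_int f"
    using assms unfolding gl2_equiv_def by blast
  have det: "(e * a + f * c) * (g * b + h * d) - (e * b + f * d) * (g * a + h * c) =
      (e * h - f * g) * (a * d - b * c)"
    by (simp add: algebra_simps)
  define L where "L = of_int c * x + of_int d"
  have "z * (of_int g * (y * L) + of_int h * L) = of_int e * (y * L) + of_int f * L"
    using arg_cong[OF 2(2), of "\<lambda>t. t * L"] by (simp add: algebra_simps)
  then have "z * (of_int (g * a + h * c) * x + of_int (g * b + h * d)) =
      of_int (e * a + f * c) * x + of_int (e * b + f * d)"
    unfolding 1(2)[folded L_def] by (simp add: L_def algebra_simps)
  then show ?thesis
    by (rule gl2_equivI[rotated]) (use 1(1) 2(1) det in auto)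
qed

lemma gl2_equiv_recip_shift:
  assumes "x \<notin> \<rat>"
  shows "gl2_equiv x (1 / (x - of_int a))"
proof (rule gl2_equivI[of 0 "-a" 1 1])
  have "x \<noteq> of_int a"
    using assms by auto
  then show "1 / (x - of_int a) * (of_int 1 * x + of_int (- a)) = of_int 0 * x + of_int 1"
    by simp
qed simp

lemma gl2_equiv_cq: "x \<notin> \<rat> \<Longrightarrow> gl2_equiv x (cq x i)"
proof (induction i)
  case (Suc i)
  then show ?case
    using gl2_equiv_trans[OF _ gl2_equiv_recip_shift[OF cq_irrational]] by simp
qed (simp add: gl2_equiv_refl)

lemma tail_equiv_imp_gl2_equiv:
  assumes "x \<notin> \<rat>" "y \<notin> \<rat>" "tail_equiv x y"
  shows "gl2_equiv x y"
proof -
  obtain i j where "cq x i = cq y j"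
    using assms(3) by (auto simp: tail_equiv_def)
  then show ?thesis
    using gl2_equiv_cq[OF assms(1), of i] gl2_equiv_cq[OF assms(2), of j]
    by (metis gl2_equiv_sym gl2_equiv_trans)
qed

text \<open>Euclid's algorithm on the first column writes a unimodular matrix as a product of shifts,
  the inversion and signs, and each of these preserves the tail of the expansion.\<close>

lemma gl2_equiv_imp_tail_equiv:
  assumes "x \<notin> \<rat>" "y \<notin> \<rat>" "gl2_equiv x y"
  shows "tail_equiv x y"
proof -
  have "tail_equiv x y" if "y \<notin> \<rat>" "a * d - b * c = 1 \<or> a * d - b * c = -1"
    "y * (of_int c * x + of_int d) = of_int a * x + of_int b" for a b c d :: int and y
    using that
  proof (induction "nat \<bar>c\<bar>" arbitrary: a b c d y rule: less_induct)
    case less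
    show ?case
    proof (cases "c = 0")
      case True
      then have ad: "a * d = 1 \<or> a * d = -1"
        using less.prems(2) by simp
      then have "d * d = 1"
        by (auto simp: zmult_eq_1_iff zmult_eq_neg1_iff)
      then have dd: "real_of_int d * real_of_int d = 1"
        by (metis of_int_1 of_int_mult)
      have "y = (y * real_of_int d) * real_of_int d"
        using dd by (simp add: mult.assoc)
      also have "y * real_of_int d = of_int a * x + of_int b"
        using less.prems(3) True by simp
      also have "\<dots> * real_of_int d = of_int (a * d) * x + of_int (b * d)"
        by (simp add: algebra_simps)
      finally have y: "y = of_int (a * d) * x + of_int (b * d)" .
      show ?thesis
        using ad
      proof
        assume "a * d = 1"
        then have "y = x + of_int (b * d)"
          unfolding y by (simp del: of_int_mult)
        then show ?thesis
          by (simp only: tail_equiv_shift)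
      next
        assume "a * d = -1"
        then have "y = - x + of_int (b * d)"
          unfolding y by (simp del: of_int_mult)
        then show ?thesis
          by (simp only: tail_equiv_trans[OF tail_equiv_uminus tail_equiv_shift])
      qed
    next
      case False
      define Q where "Q = a div c"
      define a' b' where "a' = a - Q * c" and "b' = b - Q * d"
      have a'_mod: "a' = a mod c"
        unfolding a'_def Q_def by (simp add: minus_div_mult_eq_mod)
      have "y \<noteq> of_int Q"
        using less.prems(1) by auto
      moreover have "(y - of_int Q) * (of_int c * x + of_int d) = of_int a' * x + of_int b'"
        using less.prems(3) by (simp add: a'_def b'_def algebra_simps)
      ultimately have eq: "1 / (y - of_int Q) * (of_int a' * x + of_int b') = of_int c * x + of_int d"
        by (simp add: field_simps)
      have "tail_equiv x (1 / (y - of_int Q))"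
      proof (rule less.hyps[OF _ _ _ eq])
        show "nat \<bar>a'\<bar> < nat \<bar>c\<bar>"
          using False by (simp add: a'_mod abs_mod_less)
        show "c * b' - d * a' = 1 \<or> c * b' - d * a' = -1"
          using less.prems(2) by (auto simp: a'_def b'_def algebra_simps)
      qed (rule irrational_recip_shift[OF less.prems(1)])
      also have "tail_equiv (1 / (y - of_int Q)) (y - of_int Q)"
        using tail_equiv_inverse[of "1 / (y - of_int Q)"] by simp
      also have "tail_equiv (y - of_int Q) y"
        using tail_equiv_shift[of "y - of_int Q" Q] by simp
      finally show ?thesis .
    qed
  qed
  then show ?thesis
    using assms(2,3) unfolding gl2_equiv_def by blast
qed

section \<open>Conjugates and reduced pairs\<close>

text \<open>\<open>D\<close> is the discriminant of an integral quadratic polynomial with the two roots \<open>x\<close> and \<open>w\<close>. It is a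
  parameter because the expansion preserves it, and finiteness holds for each value separately.\<close>

definition conjugates :: "int \<Rightarrow> real \<Rightarrow> real \<Rightarrow> bool" where
  "conjugates D x w \<longleftrightarrow> x \<notin> \<rat> \<and>
     (\<exists>A B C :: int. A \<noteq> 0 \<and> B\<^sup>2 - 4 * A * C = D \<and>
        of_int A * (x + w) = - of_int B \<and> of_int A * (x * w) = of_int C)"

lemma conjugatesE:
  assumes "conjugates D x w"
  obtains A B C :: int where "A \<noteq> 0" "B\<^sup>2 - 4 * A * C = D"
    "of_int A * (x + w) = - of_int B" "of_int A * (x * w) = of_int C"
  using assms unfolding conjugates_def by blast

lemma conjugates_rational:
  assumes "conjugates D x w"
  shows "x + w \<in> \<rat>" "x * w \<in> \<rat>"
proof -
  obtain A B C :: int where "A \<noteq> 0" "of_int A * (x + w) = - of_int B" "of_int A * (x * w) = of_int C"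
    using assms by (rule conjugatesE)
  then have "x + w = - of_int B / of_int A" "x * w = of_int C / of_int A"
    by (simp_all add: field_simps)
  then show "x + w \<in> \<rat>" "x * w \<in> \<rat>"
    by simp_all
qed

lemma conjugates_irrational:
  assumes "conjugates D x w"
  shows "x \<notin> \<rat>" "w \<notin> \<rat>"
proof -
  show "x \<notin> \<rat>"
    using assms by (simp add: conjugates_def)
  then show "w \<notin> \<rat>"
    using conjugates_rational(1)[OF assms] Rats_diff[of "x + w" w] by auto
qed

lemma conjugates_unique:
  assumes "conjugates D x w" "conjugates D' x w'"
  shows "w = w'"
proof (rule ccontr)
  assume "w \<noteq> w'"
  have "(x + w) - (x + w') \<in> \<rat>" "x * w - x * w' \<in> \<rat>"
    by (intro Rats_diff conjugates_rational[OF assms(1)] conjugates_rational[OF assms(2)])+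
  then have "(x * w - x * w') / ((x + w) - (x + w')) \<in> \<rat>"
    by (rule Rats_divide[rotated])
  also have "(x * w - x * w') / ((x + w) - (x + w')) = x"
    using \<open>w \<noteq> w'\<close> by (simp add: field_simps)
  finally show False
    using conjugates_irrational[OF assms(1)] by simp
qed

lemma conjugates_distinct:
  assumes "conjugates D x w"
  shows "x \<noteq> w"
proof
  assume "x = w"
  have "(x + w) / 2 \<in> \<rat>"
    using conjugates_rational(1)[OF assms] by (rule Rats_divide) simp
  also have "(x + w) / 2 = x"
    using \<open>x = w\<close> by simp
  finally show False
    using conjugates_irrational(1)[OF assms] by simp
qed

lemma conjugates_recip_shift:
  assumes "conjugates D x w"
  shows "conjugates D (1 / (x - of_int a)) (1 / (w - of_int a))"
proof -
  obtain A B C :: int where ABC: "A \<noteq> 0" "B\<^sup>2 - 4 * A * C = D"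
    "of_int A * (x + w) = - of_int B" "of_int A * (x * w) = of_int C"
    using assms by (rule conjugatesE)
  have ne: "x \<noteq> of_int a" "w \<noteq> of_int a"
    using conjugates_irrational[OF assms] by auto
  define A' B' where "A' = A * a\<^sup>2 + B * a + C" and "B' = B + 2 * A * a"
  have A': "of_int A' = of_int A * ((x - of_int a) * (w - of_int a))"
  proof -
    have B: "real_of_int B = - (of_int A * (x + w))"
      using ABC(3) by simp
    show ?thesis
      by (simp add: A'_def B ABC(4)[symmetric] algebra_simps power2_eq_square)
  qed
  have B': "- of_int B' = of_int A * ((x - of_int a) + (w - of_int a))"
  proof -
    have "of_int A * ((x - of_int a) + (w - of_int a)) = of_int A * (x + w) - 2 * of_int A * of_int a"
      by (simp add: algebra_simps)
    then show ?thesis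
      unfolding B'_def ABC(3) by simp
  qed
  have "real_of_int A' \<noteq> 0"
    using ABC(1) ne by (simp add: A')
  moreover have "B'\<^sup>2 - 4 * A' * A = D"
    unfolding A'_def B'_def using ABC(2) by (simp add: algebra_simps power2_eq_square)
  moreover have "of_int A' * (1 / (x - of_int a) + 1 / (w - of_int a)) = - of_int B'"
  proof -
    have "p * r * (1 / p + 1 / r) = p + r" if "p \<noteq> 0" "r \<noteq> 0" for p r :: real
      using that by (simp add: field_simps)
    from this[of "x - of_int a" "w - of_int a"] show ?thesis
      unfolding A' B' using ne by (simp only: mult.assoc right_minus_eq not_False_eq_True)
  qed
  moreover have "of_int A' * (1 / (x - of_int a) * (1 / (w - of_int a))) = of_int A"
    unfolding A' using ne by simp
  ultimately show ?thesis
    unfolding conjugates_def using irrational_recip_shift conjugates_irrational(1)[OF assms] by auto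
qed

text \<open>The conjugate \<open>w\<close> is carried along by the expansion of \<open>x\<close>: it is shifted by the partial
  quotients of \<open>x\<close>, not by its own.\<close>

primrec conj_cq :: "real \<Rightarrow> real \<Rightarrow> nat \<Rightarrow> real" where
  "conj_cq x w 0 = w"
| "conj_cq x w (Suc i) = 1 / (conj_cq x w i - of_int (cf_coeff x i))"

lemma conjugates_cq: "conjugates D x w \<Longrightarrow> conjugates D (cq x i) (conj_cq x w i)"
  by (induction i) (simp_all add: conjugates_recip_shift cf_coeff_def)

lemma conj_cq_cq: "conj_cq (cq x i) (conj_cq x w i) j = conj_cq x w (i + j)"
  by (induction j) (simp_all add: cf_coeff_cq)

lemma gl2_equiv_conj_cq:
  assumes "conjugates D x w"
  shows "gl2_equiv w (conj_cq x w i)"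
proof (induction i)
  case (Suc i)
  then show ?case
    using gl2_equiv_trans[OF _ gl2_equiv_recip_shift] conjugates_irrational(2)[OF conjugates_cq[OF assms]]
    by simp
qed (simp add: gl2_equiv_refl)

definition reduced :: "real \<Rightarrow> real \<Rightarrow> bool" where
  "reduced x w \<longleftrightarrow> x > 1 \<and> -1 < w \<and> w < 0"

lemma cf_coeff_ge_1: "x > 1 \<Longrightarrow> cf_coeff x 0 \<ge> 1"
  by (simp add: cf_coeff_def le_floor_iff)

lemma reduced_step_neg:
  assumes "conjugates D x w" "x > 1" "w < 0"
  shows "reduced (cq x 1) (conj_cq x w 1)"
proof -
  have "real_of_int (cf_coeff x 0) \<ge> 1"
    using cf_coeff_ge_1[OF assms(2)] by simp
  then have "w - of_int (cf_coeff x 0) < -1"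
    using assms(3) by linarith
  then have "-1 < conj_cq x w 1" "conj_cq x w 1 < 0"
    by (simp_all add: field_simps)
  then show ?thesis
    using cq_Suc_gt_1[OF conjugates_irrational(1)[OF assms(1)], of 0] by (simp add: reduced_def)
qed

lemma reduced_cq:
  assumes "conjugates D x w" "reduced x w"
  shows "reduced (cq x i) (conj_cq x w i)"
proof (induction i)
  case (Suc i)
  then show ?case
    using reduced_step_neg[OF conjugates_cq[OF assms(1), of i]] cq_cq[of x i 1] conj_cq_cq[of x i w 1]
    by (simp add: reduced_def)
qed (use assms in simp)

text \<open>As long as the conjugate has the same integer part as \<open>x\<close>, it follows its own expansion;
  since the expansion determines the number, it must deviate at some point. The first deviation
  makes it negative after at most two steps, and one step later it lies between -1 and 0 for good.\<close>

lemma eventually_reduced: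
  assumes "conjugates D x w"
  shows "\<exists>N. \<forall>i\<ge>N. reduced (cq x i) (conj_cq x w i)"
proof -
  let ?w = "conj_cq x w" and ?a = "\<lambda>i. real_of_int (cf_coeff x i)"
  note conj = conjugates_cq[OF assms]
  have irr: "x \<notin> \<rat>" "w \<notin> \<rat>"
    using conjugates_irrational[OF assms] by auto
  have gt1: "cq x (Suc i) > 1" for i
    by (rule cq_Suc_gt_1) fact
  have "\<exists>i. \<not> (0 < ?w i - ?a i \<and> ?w i - ?a i < 1)"
  proof (rule ccontr)
    assume "\<not> ?thesis"
    then have *: "\<lfloor>?w i\<rfloor> = cf_coeff x i" for i
      by (metis add_0 diff_less_eq floor_unique less_diff_eq less_eq_real_def add.commute)
    have "cq w i = ?w i" for i
      by (induction i) (simp_all add: *)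
    then have "cf_coeff w i = cf_coeff x i" for i
      using * by (simp add: cf_coeff_def)
    then show False
      using cf_coeff_inject[of x w] irr conjugates_distinct[OF assms] by simp
  qed
  then obtain i where i: "\<not> (0 < ?w i - ?a i \<and> ?w i - ?a i < 1)" ..
  have "?w i \<notin> \<rat>"
    using conjugates_irrational(2)[OF conj] .
  then have ne: "?w i - ?a i \<noteq> 0" "?w i - ?a i \<noteq> 1"
    by (metis Rats_of_int right_minus_eq, metis Rats_1 Rats_add Rats_of_int diff_add_cancel)
  have "\<exists>j. cq x j > 1 \<and> ?w j < 0"
  proof (cases "?w i - ?a i < 0")
    case True
    then have "?w (Suc i) < 0"
      by simp
    then show ?thesis
      using gt1 by blast
  next
    case False
    then have "?w i - ?a i > 1"
      using i ne by linarith
    then have "?w (Suc i) < 1"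
      by simp
    moreover have "?a (Suc i) \<ge> 1"
      using cf_coeff_ge_1[OF gt1[of i]] cf_coeff_cq[of x "Suc i" 0]
      by (simp del: cf_complete_quotient.simps)
    ultimately have "?w (Suc i) - ?a (Suc i) < 0"
      by linarith
    then have "?w (Suc (Suc i)) < 0"
      by (subst conj_cq.simps(2)) (simp only: divide_less_0_1_iff)
    then show ?thesis
      using gt1 by blast
  qed
  then obtain j where "cq x j > 1" "?w j < 0"
    by blast
  then have red: "reduced (cq x (Suc j)) (?w (Suc j))"
    using reduced_step_neg[OF conj, of j] cq_cq[of x j 1] conj_cq_cq[of x j w 1] by simp
  have "reduced (cq x k) (?w k)" if "k \<ge> Suc j" for k
    using reduced_cq[OF conj red, of "k - Suc j"] that by (simp only: cq_cq conj_cq_cq) simp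
  then show ?thesis
    by blast
qed

section \<open>Lagrange's theorem\<close>

text \<open>The opposite signs of the roots make \<open>B\<^sup>2\<close> and \<open>-4 * A * C\<close> both nonnegative in
  \<open>B\<^sup>2 - 4 * A * C = D\<close>, which bounds all coefficients.\<close>

lemma finite_reduced: "finite {x. \<exists>w. conjugates D x w \<and> reduced x w}"
proof -
  define S where "S = {-\<bar>D\<bar>..\<bar>D\<bar>}"
  \<comment> \<open>A reduced number is the only positive root of its polynomial, hence recovered from the coefficients.\<close>
  define root where "root = (\<lambda>(A, B, C). THE x. x > 0 \<and>
    real_of_int A * x\<^sup>2 + of_int B * x + of_int C = 0)"
  have "x \<in> root ` (S \<times> S \<times> S)" if conj: "conjugates D x w" and red: "reduced x w" for x w
  proof -
    obtain A B C :: int where ABC: "A \<noteq> 0" "B\<^sup>2 - 4 * A * C = D"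
      "of_int A * (x + w) = - of_int B" "of_int A * (x * w) = of_int C"
      using conj by (rule conjugatesE)
    have xw: "x > 0" "w < 0" "x * w < 0"
      using red by (auto simp: reduced_def mult_pos_neg)
    have "real_of_int A * of_int C = (of_int A)\<^sup>2 * (x * w)"
      by (simp add: ABC(4)[symmetric] power2_eq_square)
    also have "\<dots> < 0"
      using ABC(1) xw by (simp add: mult_pos_neg)
    finally have AC: "A * C < 0"
      by (metis of_int_less_0_iff of_int_mult)
    have "\<bar>t\<bar> \<le> t\<^sup>2" for t :: int
    proof -
      have "\<bar>t\<bar> * 1 \<le> \<bar>t\<bar> * \<bar>t\<bar>"
        using abs_ge_zero[of t] by (cases "t = 0") (simp, intro mult_left_mono, linarith+)
      then show ?thesis
        by (metis mult_1_right abs_mult_self_eq power2_eq_square)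
    qed
    then have "\<bar>B\<bar> \<le> B\<^sup>2" .
    moreover have "\<bar>A\<bar> \<le> - (A * C)" "\<bar>C\<bar> \<le> - (A * C)"
    proof -
      have "A \<noteq> 0" "C \<noteq> 0" "- (A * C) = \<bar>A\<bar> * \<bar>C\<bar>"
        using AC by (auto simp: abs_mult[symmetric])
      then show "\<bar>A\<bar> \<le> - (A * C)" "\<bar>C\<bar> \<le> - (A * C)"
        using mult_left_mono[of 1 "\<bar>C\<bar>" "\<bar>A\<bar>"] mult_right_mono[of 1 "\<bar>A\<bar>" "\<bar>C\<bar>"] by auto
    qed
    ultimately have "(A, B, C) \<in> S \<times> S \<times> S"
      using ABC(2) AC zero_le_power2[of B] by (auto simp: S_def)
    moreover have "root (A, B, C) = x"
    proof -
      have fact: "real_of_int A * t\<^sup>2 + of_int B * t + of_int C = of_int A * ((t - x) * (t - w))" for t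
      proof -
        have B: "real_of_int B = - (of_int A * (x + w))"
          using ABC(3) by simp
        show ?thesis
          by (simp add: B ABC(4)[symmetric] algebra_simps power2_eq_square)
      qed
      show ?thesis
        unfolding root_def prod.case fact using xw ABC(1) by (intro the_equality) auto
    qed
    ultimately show ?thesis
      by (metis image_eqI)
  qed
  then have "{x. \<exists>w. conjugates D x w \<and> reduced x w} \<subseteq> root ` (S \<times> S \<times> S)"
    by blast
  then show ?thesis
    by (rule finite_subset) (simp add: S_def)
qed

lemma cq_periodic_mult:
  assumes "cq x k = x"
  shows "cq x (l * k + i) = cq x i"
proof (induction l)
  case (Suc l)
  have "cq x (Suc l * k + i) = cq (cq x k) (l * k + i)"
    by (simp add: cq_cq add.assoc)
  then show ?case
    using Suc assms by simp
qed simp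

lemma cf_coeff_periodic:
  assumes "cq x k = x"
  shows "cf_coeff x i = cf_coeff x (i mod k)"
  using cq_periodic_mult[OF assms, of "i div k" "i mod k"] by (simp add: cf_coeff_def)

lemma pure_period:
  assumes "cq x k = x" "k > 0"
  shows "has_cf_period x (map (cf_coeff x) [0..<k])"
  unfolding has_cf_period_def
  using assms cf_coeff_periodic[OF assms(1)] by (auto intro!: exI[of _ 0])

lemma Lagrange:
  assumes "conjugates D x w"
  shows "\<exists>bs. has_cf_period x bs"
proof -
  obtain N where N: "\<And>i. i \<ge> N \<Longrightarrow> reduced (cq x i) (conj_cq x w i)"
    using eventually_reduced[OF assms] by blast
  then have "cq x ` {N..} \<subseteq> {x. \<exists>w. conjugates D x w \<and> reduced x w}"
    using conjugates_cq[OF assms] by auto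
  then have "finite (cq x ` {N..})"
    by (rule finite_subset[OF _ finite_reduced])
  then have "\<not> inj_on (cq x) {N..}"
    using finite_imageD infinite_Ici by blast
  then obtain i j where "i < j" "cq x i = cq x j"
    unfolding inj_on_def by (metis linorder_neqE_nat)
  have "cq (cq x i) (j - i) = cq x j"
    using \<open>i < j\<close> by (simp add: cq_cq)
  also have "\<dots> = cq x i"
    using \<open>cq x i = cq x j\<close> by simp
  finally have "cq (cq x i) (j - i) = cq x i" .
  then have "has_cf_period (cq x i) (map (cf_coeff (cq x i)) [0..<j - i])"
    using \<open>i < j\<close> by (intro pure_period) auto
  moreover have "tail_equiv (cq x i) x"
    unfolding tail_equiv_def using cq_cq[of x i 0] by blast
  ultimately show ?thesis
    using has_cf_period_tail_equiv by blast
qed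

section \<open>Galois' theorem on reversed periods\<close>

text \<open>In terms of \<open>u\<^sub>i = -1 / w\<^sub>i\<close> the conjugate recursion reads \<open>u\<^sub>i\<^sub>+\<^sub>1 = a\<^sub>i + 1 / u\<^sub>i\<close>, with \<open>u\<^sub>i > 1\<close>
  for reduced pairs: this is the expansion algorithm run backwards.\<close>

lemma Galois_pure:
  assumes "conjugates D x w" "reduced x w" "cq x k = x" "k > 0"
  shows "has_cf_period (-1 / w) (rev (map (cf_coeff x) [0..<k]))"
proof -
  let ?w = "conj_cq x w"
  have "conjugates D x (?w k)"
    using conjugates_cq[OF assms(1), of k] assms(3) by simp
  then have wk: "?w k = w"
    using assms(1) conjugates_unique by blast
  have step: "\<lfloor>-1 / ?w (Suc i)\<rfloor> = cf_coeff x i"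
    "1 / (-1 / ?w (Suc i) - of_int (cf_coeff x i)) = -1 / ?w i" for i
  proof -
    have "-1 < ?w i" "?w i < 0"
      using reduced_cq[OF assms(1,2), of i] by (auto simp: reduced_def)
    moreover have eq: "-1 / ?w (Suc i) = of_int (cf_coeff x i) - ?w i"
      by simp
    ultimately show "\<lfloor>-1 / ?w (Suc i)\<rfloor> = cf_coeff x i"
      unfolding eq by linarith
    show "1 / (-1 / ?w (Suc i) - of_int (cf_coeff x i)) = -1 / ?w i"
      unfolding eq by simp
  qed
  define u where "u = -1 / w"
  have backward: "cq u i = -1 / ?w (k - i)" if "i \<le> k" for i
    using that
  proof (induction i)
    case (Suc i)
    have "k - i = Suc (k - Suc i)"
      using Suc.prems by simp
    then have "cq u i = -1 / ?w (Suc (k - Suc i))"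
      using Suc by simp
    then show ?case
      using step[of "k - Suc i"] by (simp only: cf_complete_quotient.simps)
  qed (simp add: wk u_def)
  have coeff: "cf_coeff u i = cf_coeff x (k - Suc i)" if "i < k" for i
  proof -
    have "k - i = Suc (k - Suc i)"
      using that by simp
    then show ?thesis
      using backward[of i] that step(1)[of "k - Suc i"] by (simp only: cf_coeff_def)
  qed
  have "map (cf_coeff u) [0..<k] = rev (map (cf_coeff x) [0..<k])"
    by (rule nth_equalityI) (simp_all add: coeff rev_nth)
  moreover have "has_cf_period u (map (cf_coeff u) [0..<k])"
    using assms(4) backward[of k] by (intro pure_period) (auto simp: u_def)
  ultimately show ?thesis
    by (simp add: u_def)
qed

text \<open>Past its pre-period \<open>x\<close> becomes a reduced, purely periodic \<open>X\<close> with conjugate \<open>W\<close>. The number \<open>-1 / W\<close>,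
  which has the reversed period, is equivalent to \<open>- w\<close>, and a period depends only on the tail.\<close>

lemma Galois_reversed_period:
  assumes "conjugates D x w" "has_cf_period x bs"
  shows "has_cf_period (- w) (rev bs)"
proof -
  let ?k = "length bs"
  obtain p where bs: "bs \<noteq> []" and p: "\<And>t. cf_coeff x (p + t) = bs ! (t mod ?k)"
    using assms(2) by (auto simp: has_cf_period_def)
  obtain N where N: "\<And>i. i \<ge> N \<Longrightarrow> reduced (cq x i) (conj_cq x w i)"
    using eventually_reduced[OF assms(1)] by blast
  \<comment> \<open>Skip \<open>N\<close> whole periods, to be past the first \<open>N\<close> complete quotients.\<close>
  define j where "j = p + N * ?k"
  have "N \<le> j"
    using bs by (cases bs) (auto simp: j_def)
  have a: "cf_coeff x (j + t) = bs ! (t mod ?k)" for t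
    using p[of "N * ?k + t"] by (simp add: j_def add.assoc)
  define X W where "X = cq x j" and "W = conj_cq x w j"
  have XW: "conjugates D X W" "reduced X W"
    unfolding X_def W_def using conjugates_cq[OF assms(1)] N \<open>N \<le> j\<close> by auto
  have irr: "X \<notin> \<rat>" "W \<notin> \<rat>" "w \<notin> \<rat>"
    using conjugates_irrational[OF XW(1)] conjugates_irrational[OF assms(1)] by auto
  have "cq X ?k = X"
    by (rule cf_coeff_inject)
      (simp_all add: cq_irrational irr, simp add: X_def cf_coeff_cq a add.assoc)
  then have "has_cf_period (-1 / W) (rev (map (cf_coeff X) [0..<?k]))"
    using Galois_pure[OF XW] bs by simp
  also have "map (cf_coeff X) [0..<?k] = bs"
    by (rule nth_equalityI) (simp_all add: X_def cf_coeff_cq a)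
  finally have per: "has_cf_period (-1 / W) (rev bs)" .
  have "tail_equiv W w"
    using irr gl2_equiv_imp_tail_equiv gl2_equiv_sym gl2_equiv_conj_cq[OF assms(1), of j]
    unfolding W_def by blast
  have "tail_equiv (-1 / W) (1 / W)"
    using tail_equiv_uminus[of "-1 / W"] by simp
  also have "tail_equiv (1 / W) W"
    using tail_equiv_sym tail_equiv_inverse by blast
  also have "tail_equiv W w"
    by fact
  also have "tail_equiv w (- w)"
    by (rule tail_equiv_uminus)
  finally show ?thesis
    using per has_cf_period_tail_equiv by blast
qed

lemma conjugates_imp_quadratic_irrational:
  assumes "conjugates D x w"
  shows "quadratic_irrational x"
proof -
  obtain A B C :: int where ABC: "A \<noteq> 0"
    "of_int A * (x + w) = - of_int B" "of_int A * (x * w) = of_int C"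
    using assms by (rule conjugatesE)
  have B: "real_of_int B = - (of_int A * (x + w))"
    using ABC(2) by simp
  have "of_int A * x\<^sup>2 + of_int B * x + of_int C = 0"
    unfolding B ABC(3)[symmetric] by (simp add: algebra_simps power2_eq_square)
  then show ?thesis
    unfolding quadratic_irrational_def using ABC(1) conjugates_irrational(1)[OF assms] by blast
qed

lemma inverse_periods_iff_gl2_equiv:
  assumes "conjugates D x w" "conjugates E y z"
  shows "inverse_periods x y \<longleftrightarrow> gl2_equiv (- w) y"
proof -
  have irr: "- w \<notin> \<rat>" "y \<notin> \<rat>"
    using conjugates_irrational(2)[OF assms(1)] conjugates_irrational(1)[OF assms(2)] by auto
  show ?thesis
  proof
    assume "inverse_periods x y"
    then obtain bs where "has_cf_period x bs" "has_cf_period y (rev bs)"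
      by (auto simp: inverse_periods_def)
    then show "gl2_equiv (- w) y"
      using Galois_reversed_period[OF assms(1)] irr
      by (blast intro: tail_equiv_imp_gl2_equiv has_cf_period_imp_tail_equiv)
  next
    assume "gl2_equiv (- w) y"
    then have "tail_equiv (- w) y"
      using irr by (intro gl2_equiv_imp_tail_equiv)
    moreover obtain bs where bs: "has_cf_period x bs"
      using Lagrange[OF assms(1)] by blast
    ultimately have "has_cf_period y (rev bs)"
      using Galois_reversed_period[OF assms(1) bs] has_cf_period_tail_equiv by blast
    then show "inverse_periods x y"
      using bs conjugates_imp_quadratic_irrational assms unfolding inverse_periods_def by blast
  qed
qed

section \<open>The Pell equation\<close>

lemma sqrt_nonsquare_irrational:
  fixes v :: int
  assumes "v > 0" "\<nexists>k :: int. v = k\<^sup>2"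
  shows "sqrt (of_int v) \<notin> \<rat>"
proof
  assume "sqrt (of_int v) \<in> \<rat>"
  then obtain a b :: int where ab: "b > 0" "coprime a b" "sqrt (of_int v) = of_int a / of_int b"
    by (rule Rats_cases')
  have "of_int v = (of_int a / of_int b :: real)\<^sup>2"
    using assms(1) by (simp flip: ab(3))
  then have "real_of_int (v * b\<^sup>2) = real_of_int (a\<^sup>2)"
    using ab(1) by (simp add: field_simps)
  then have eq: "v * b\<^sup>2 = a\<^sup>2"
    by (simp only: of_int_eq_iff)
  then have "b\<^sup>2 dvd a\<^sup>2"
    by (metis dvd_triv_right)
  then have "b dvd a"
    by simp
  then have "b = 1"
    using ab(1,2) by (simp add: coprime_absorb_right)
  then show False
    using eq assms(2) by auto
qed

lemma int_lincomb_irrational_eq: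
  fixes a b c d :: int
  assumes "s \<notin> \<rat>" "of_int a + of_int b * s = of_int c + of_int d * s"
  shows "a = c" "b = d"
proof -
  have eq: "of_int (b - d) * s = of_int (c - a)"
    using assms(2) by (simp add: algebra_simps)
  show "b = d"
  proof (rule ccontr)
    assume "b \<noteq> d"
    then have "s = of_int (c - a) / of_int (b - d)"
      using eq by (simp add: field_simps)
    then have "s \<in> \<rat>"
      by (metis Rats_divide Rats_of_int)
    then show False
      using assms(1) by contradiction
  qed
  then show "a = c"
    using eq by simp
qed

text \<open>If \<open>(a z + b) / (c z + d) = y\<close> for the two numbers \<open>z\<close>, \<open>y\<close> below, then comparing the coefficients
  of \<open>\<surd>v\<close> gives \<open>a - c n / q = d - c m / q\<close>; with \<open>r\<close> for this number the determinant becomes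
  \<open>r\<^sup>2 - c\<^sup>2 v\<close>. Hence \<open>r\<close> is an integer, so \<open>q\<close> divides \<open>c n\<close> and thus \<open>c\<close>. The matrix is recovered
  from \<open>r\<close> and \<open>c = q e\<close>, and the last condition is the integrality of \<open>b\<close>.\<close>

lemma gl2_equiv_shifted_sqrt_iff:
  fixes v q m n :: int
  assumes "v > 0" "q > 0" "\<nexists>k :: int. v = k\<^sup>2" "gcd n q = 1"
  defines "s \<equiv> sqrt (of_int v)"
  shows "gl2_equiv (- of_int m / of_int q + s) (of_int n / of_int q + s) \<longleftrightarrow>
    (\<exists>r e :: int. (r\<^sup>2 - (q * e)\<^sup>2 * v = 1 \<or> r\<^sup>2 - (q * e)\<^sup>2 * v = -1) \<and>
       q dvd r * (m + n) + e * m * n)"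
    (is "?equiv \<longleftrightarrow> ?pell")
proof
  have irr: "s \<notin> \<rat>"
    unfolding s_def by (rule sqrt_nonsquare_irrational) fact+
  have s2: "s * s = of_int v"
    using assms(1) by (simp add: s_def)
  assume ?equiv
  then obtain a b c d :: int where det: "a * d - b * c = 1 \<or> a * d - b * c = -1"
    and eq: "(of_int n / of_int q + s) * (of_int c * (- of_int m / of_int q + s) + of_int d) =
      of_int a * (- of_int m / of_int q + s) + of_int b"
    unfolding gl2_equiv_def by blast
  have "(of_int n + of_int q * s) * (of_int c * (- of_int m + of_int q * s) + of_int d * of_int q) =
      of_int q * (of_int a * (- of_int m + of_int q * s) + of_int b * of_int q)"
  proof -
    let ?y = "of_int n / of_int q + s" and ?z = "- of_int m / of_int q + s"
    have "of_int n + of_int q * s = of_int q * ?y" "- of_int m + of_int q * s = of_int q * ?z"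
      using assms(2) by (simp_all add: algebra_simps)
    then show ?thesis
      using arg_cong[OF eq, of "\<lambda>t. t * (of_int q * of_int q)"]
      by (simp only:) (simp only: algebra_simps)
  qed
  then have "real_of_int (n * (q * d - c * m) + c * q\<^sup>2 * v) + of_int (q * (q * d - c * m + c * n)) * s =
      of_int (q * (q * b - a * m)) + of_int (q * (q * a)) * s"
    by (simp add: algebra_simps power2_eq_square flip: s2)
  note coeffs = int_lincomb_irrational_eq[OF irr this]
  \<comment> \<open>\<open>R = q r\<close>; that \<open>r\<close> is an integer follows from the determinant below.\<close>
  define R where "R = q * d - c * m"
  have qd: "q * d = R + c * m" and qa: "q * a = R + c * n"
    using coeffs(2) assms(2) by (simp_all add: R_def)
  have "n * R + c * q\<^sup>2 * v = q * (q * b) - (q * a) * m"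
    using coeffs(1) by (simp add: R_def algebra_simps)
  then have qb: "q * (q * b) = R * (m + n) + c * m * n + c * q\<^sup>2 * v"
    unfolding qa by (simp add: algebra_simps)
  have "q\<^sup>2 * (a * d - b * c) = (q * a) * (q * d) - (q * (q * b)) * c"
    by (simp add: algebra_simps power2_eq_square)
  also have "\<dots> = R\<^sup>2 - q\<^sup>2 * (c\<^sup>2 * v)"
    unfolding qa qb qd by (simp add: algebra_simps power2_eq_square)
  finally have norm: "R\<^sup>2 = q\<^sup>2 * (a * d - b * c + c\<^sup>2 * v)"
    by (simp add: algebra_simps)
  then have "q\<^sup>2 dvd R\<^sup>2"
    by simp
  then have "q dvd R"
    by simp
  then obtain r where r: "R = q * r"
    by (rule dvdE)
  have "c * n = q * (a - r)"
    using qa by (simp add: r algebra_simps)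
  then have "q dvd c"
    using assms(4) by (metis coprime_dvd_mult_left_iff coprime_iff_gcd_eq_1 dvd_triv_left gcd.commute)
  then obtain e where e: "c = q * e"
    by (rule dvdE)
  have "q\<^sup>2 * (r\<^sup>2 - c\<^sup>2 * v) = q\<^sup>2 * (a * d - b * c)"
    using norm by (simp add: r algebra_simps power_mult_distrib)
  then have "r\<^sup>2 - c\<^sup>2 * v = a * d - b * c"
    using assms(2) by simp
  moreover have "q * (q * b) = q * (r * (m + n) + e * m * n + q * (q * e * v))"
    using qb by (simp add: r e algebra_simps power2_eq_square)
  then have "q * b = r * (m + n) + e * m * n + q * (q * e * v)"
    using assms(2) by (metis mult_left_cancel less_irrefl)
  then have "r * (m + n) + e * m * n = q * (b - q * e * v)"
    by (simp add: algebra_simps)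
  ultimately show ?pell
    using det e by (metis dvd_triv_left)
next
  have s2: "s * s = of_int v"
    using assms(1) by (simp add: s_def)
  assume ?pell
  then obtain r e :: int where norm: "r\<^sup>2 - (q * e)\<^sup>2 * v = 1 \<or> r\<^sup>2 - (q * e)\<^sup>2 * v = -1"
    and "q dvd r * (m + n) + e * m * n"
    by blast
  then obtain b' where b': "r * (m + n) + e * m * n = q * b'"
    by (blast elim: dvdE)
  have "(r + e * n) * (r + e * m) - (b' + q * e * v) * (q * e) =
      r\<^sup>2 - (q * e)\<^sup>2 * v + e * (r * (m + n) + e * m * n - q * b')"
    by (simp add: algebra_simps power2_eq_square)
  then have det: "(r + e * n) * (r + e * m) - (b' + q * e * v) * (q * e) = r\<^sup>2 - (q * e)\<^sup>2 * v"
    by (simp add: b')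
  have b'_real: "real_of_int b' = (of_int r * (of_int m + of_int n) + of_int e * of_int m * of_int n) / of_int q"
    using arg_cong[OF b', of real_of_int] assms(2) by (simp add: field_simps)
  show ?equiv
  proof (rule gl2_equivI)
    show "(r + e * n) * (r + e * m) - (b' + q * e * v) * (q * e) = 1 \<or>
        (r + e * n) * (r + e * m) - (b' + q * e * v) * (q * e) = -1"
      unfolding det by (rule norm)
    show "(of_int n / of_int q + s) *
        (of_int (q * e) * (- of_int m / of_int q + s) + of_int (r + e * m)) =
        of_int (r + e * n) * (- of_int m / of_int q + s) + of_int (b' + q * e * v)"
      using assms(2) by (simp add: b'_real field_simps flip: s2)
  qed
qed

text \<open>\<open>R + q E \<surd>v\<close> is the \<open>k\<close>-th power of \<open>r + q e \<surd>v\<close>. Modulo \<open>q\<close>, only the first two terms of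
  the binomial expansion matter, giving \<open>R \<equiv> r\<^sup>k\<close> and \<open>E \<equiv> k r\<^sup>k\<^sup>-\<^sup>1 e\<close>; the factor \<open>r\<close> in the
  last congruence avoids the exponent \<open>k - 1\<close> at \<open>k = 0\<close>.\<close>

lemma Pell_power:
  fixes v q r e :: int
  shows "\<exists>R E. R\<^sup>2 - (q * E)\<^sup>2 * v = (r\<^sup>2 - (q * e)\<^sup>2 * v) ^ k \<and>
    [R = r ^ k] (mod q) \<and> [r * E = int k * r ^ k * e] (mod q)"
proof (induction k)
  case 0
  show ?case
    by (rule exI[of _ 1], rule exI[of _ 0]) auto
next
  case (Suc k)
  then obtain R E where *: "R\<^sup>2 - (q * E)\<^sup>2 * v = (r\<^sup>2 - (q * e)\<^sup>2 * v) ^ k"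
    "[R = r ^ k] (mod q)" "[r * E = int k * r ^ k * e] (mod q)"
    by blast
  define R' E' where "R' = R * r + q * (q * E * e * v)" and "E' = R * e + E * r"
  have "R'\<^sup>2 - (q * E')\<^sup>2 * v = (r\<^sup>2 - (q * e)\<^sup>2 * v) * (R\<^sup>2 - (q * E)\<^sup>2 * v)"
    by (simp add: R'_def E'_def algebra_simps power2_eq_square)
  moreover have "[R' = r ^ Suc k] (mod q)"
  proof -
    have "[R' = R * r] (mod q)"
      by (simp add: R'_def cong_def)
    also have "[R * r = r ^ k * r] (mod q)"
      using *(2) by (rule cong_scalar_right)
    finally show ?thesis
      by (simp add: mult.commute)
  qed
  moreover have "[r * E' = int (Suc k) * r ^ Suc k * e] (mod q)"
  proof -
    have "r * E' = R * (r * e) + (r * E) * r"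
      by (simp add: E'_def algebra_simps)
    also have "[\<dots> = r ^ k * (r * e) + (int k * r ^ k * e) * r] (mod q)"
      using *(2,3) by (intro cong_add cong_scalar_right)
    finally show ?thesis
      by (simp add: algebra_simps)
  qed
  ultimately show ?case
    using *(1) by (metis power_Suc)
qed

lemma Pell_coprime:
  fixes v q r e :: int
  assumes "r\<^sup>2 - (q * e)\<^sup>2 * v = 1 \<or> r\<^sup>2 - (q * e)\<^sup>2 * v = -1"
  shows "coprime r q"
proof (rule coprimeI)
  fix t assume "t dvd r" "t dvd q"
  then have "t dvd r\<^sup>2 - (q * e)\<^sup>2 * v"
    by (simp add: power2_eq_square)
  then show "is_unit t"
    using assms by auto
qed

text \<open>In the congruence \<open>r\<close>, \<open>m\<close> and \<open>n\<close> are units modulo \<open>q\<close>, so \<open>e\<close> and \<open>m + n\<close> have the same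
  greatest common divisor with \<open>q\<close>. Conversely, replacing \<open>r + q e \<surd>v\<close> by its \<open>k\<close>-th power turns the
  congruence into \<open>r (m + n) + k e m n \<equiv> 0\<close> (up to a unit), which is linear in \<open>k\<close> and solvable by the
  equality of the divisors.\<close>

lemma Pell_congruence_iff:
  fixes v q m n :: int
  assumes "q > 0" "gcd m q = 1" "gcd n q = 1"
  shows "(\<exists>r e :: int. (r\<^sup>2 - (q * e)\<^sup>2 * v = 1 \<or> r\<^sup>2 - (q * e)\<^sup>2 * v = -1) \<and>
       q dvd r * (m + n) + e * m * n) \<longleftrightarrow>
    (\<exists>r e :: int. (r\<^sup>2 - (q * e)\<^sup>2 * v = 1 \<or> r\<^sup>2 - (q * e)\<^sup>2 * v = -1) \<and>
       gcd e q = gcd (m + n) q)"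
proof -
  have cop: "coprime q (m * n)"
    using assms(2,3) by (simp add: gcd_eq_1_imp_coprime gcd.commute)
  have gcd_emn: "gcd (e * m * n) q = gcd e q" for e
    using gcd_mult_left_left_cancel[OF cop, of e] by (simp add: mult_ac)
  have "gcd e q = gcd (m + n) q"
    if norm: "r\<^sup>2 - (q * e)\<^sup>2 * v = 1 \<or> r\<^sup>2 - (q * e)\<^sup>2 * v = -1"
      and dvd: "q dvd r * (m + n) + e * m * n" for r e
  proof -
    have "[e * m * n = - (r * (m + n))] (mod q)"
      using dvd by (simp add: cong_iff_dvd_diff add.commute)
    then have "gcd (e * m * n) q = gcd (- (r * (m + n))) q"
      by (rule cong_gcd_eq)
    then show ?thesis
      using gcd_mult_left_left_cancel[of q r "m + n"] Pell_coprime[OF norm] by (simp add: gcd_emn coprime_commute)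
  qed
  moreover have "\<exists>R E. (R\<^sup>2 - (q * E)\<^sup>2 * v = 1 \<or> R\<^sup>2 - (q * E)\<^sup>2 * v = -1) \<and>
      q dvd R * (m + n) + E * m * n"
    if norm: "r\<^sup>2 - (q * e)\<^sup>2 * v = 1 \<or> r\<^sup>2 - (q * e)\<^sup>2 * v = -1"
      and gcd: "gcd e q = gcd (m + n) q" for r e
  proof -
    let ?g = "gcd (m + n) q"
    obtain t where t: "[e * m * n * t = ?g] (mod q)"
      using cong_solve_int[of "e * m * n" q] gcd gcd_emn[of e] by auto
    obtain h where h: "m + n = ?g * h"
      by (metis dvdE gcd_dvd1)
    \<comment> \<open>\<open>t\<close> inverts \<open>e m n\<close> up to the common divisor, so this \<open>k\<close> solves the linear congruence.\<close>
    define k where "k = nat ((- t * r * h) mod q)"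
    have k: "[int k = - t * r * h] (mod q)"
      using assms(1) by (simp add: k_def cong_def)
    have "[e * m * n * int k = e * m * n * (- t * r * h)] (mod q)"
      using k by (rule cong_scalar_left)
    also have "e * m * n * (- t * r * h) = (e * m * n * t) * (- r * h)"
      by (simp add: algebra_simps)
    also have "[\<dots> = ?g * (- r * h)] (mod q)"
      using t by (rule cong_scalar_right)
    also have "?g * (- r * h) = - r * (m + n)"
      by (subst h) (simp add: mult_ac)
    finally have "[r * (m + n) + e * m * n * int k = r * (m + n) + - r * (m + n)] (mod q)"
      by (intro cong_add cong_refl)
    then have lin: "q dvd r * (m + n) + e * m * n * int k"
      by (simp add: cong_0_iff)
    obtain R E where RE: "R\<^sup>2 - (q * E)\<^sup>2 * v = (r\<^sup>2 - (q * e)\<^sup>2 * v) ^ k"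
      "[R = r ^ k] (mod q)" "[r * E = int k * r ^ k * e] (mod q)"
      using Pell_power by blast
    have "r * (R * (m + n) + E * m * n) = R * (r * (m + n)) + (r * E) * (m * n)"
      by (simp add: algebra_simps)
    also have "[\<dots> = r ^ k * (r * (m + n)) + (int k * r ^ k * e) * (m * n)] (mod q)"
      using RE(2,3) by (intro cong_add cong_scalar_right)
    also have "r ^ k * (r * (m + n)) + (int k * r ^ k * e) * (m * n) =
        r ^ k * (r * (m + n) + e * m * n * int k)"
      by (simp add: algebra_simps)
    also have "[\<dots> = 0] (mod q)"
      using lin by (simp add: cong_0_iff)
    finally have "q dvd r * (R * (m + n) + E * m * n)"
      by (simp add: cong_0_iff)
    then have "q dvd R * (m + n) + E * m * n"
      using Pell_coprime[OF norm] by (simp add: coprime_dvd_mult_right_iff coprime_commute)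
    moreover have "R\<^sup>2 - (q * E)\<^sup>2 * v = 1 \<or> R\<^sup>2 - (q * E)\<^sup>2 * v = -1"
      using norm neg_one_even_power neg_one_odd_power unfolding RE(1)
      by (cases "even k") auto
    ultimately show ?thesis
      by blast
  qed
  ultimately show ?thesis
    by blast
qed

lemma conjugates_shifted_sqrt:
  fixes v q m :: int
  assumes "v > 0" "q > 0" "\<nexists>k :: int. v = k\<^sup>2"
  shows "conjugates ((2 * q * m)\<^sup>2 - 4 * q\<^sup>2 * (m\<^sup>2 - q\<^sup>2 * v))
    (of_int m / of_int q + sqrt (of_int v)) (of_int m / of_int q - sqrt (of_int v))"
proof -
  let ?s = "sqrt (of_int v)"
  have "of_int m / of_int q + ?s \<notin> \<rat>"
  proof
    assume "of_int m / of_int q + ?s \<in> \<rat>"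
    then have "(of_int m / of_int q + ?s) - of_int m / of_int q \<in> \<rat>"
      by (intro Rats_diff Rats_divide Rats_of_int)
    then show False
      using sqrt_nonsquare_irrational[OF assms(1,3)] by simp
  qed
  moreover have "?s * ?s = of_int v"
    using assms(1) by simp
  then have "of_int (q\<^sup>2) * ((of_int m / of_int q + ?s) * (of_int m / of_int q - ?s)) =
      real_of_int (m\<^sup>2 - q\<^sup>2 * v)"
    using assms(2) by (simp add: field_simps power2_eq_square)
  moreover have "of_int (q\<^sup>2) * ((of_int m / of_int q + ?s) + (of_int m / of_int q - ?s)) =
      - real_of_int (- 2 * q * m)"
    using assms(2) by (simp add: field_simps power2_eq_square)
  ultimately show ?thesis
    using assms(2) unfolding conjugates_def
    by (intro conjI exI[of _ "q\<^sup>2"] exI[of _ "- 2 * q * m"] exI[of _ "m\<^sup>2 - q\<^sup>2 * v"]) auto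
qed

theorem corollary1:
  fixes v q m n :: int and x y :: real
  assumes "v > 0" and "q > 0"
    and "\<nexists>k :: int. v = k\<^sup>2"
    and "gcd m q = 1" and "gcd n q = 1"
    and "x = of_int m / of_int q + sqrt (of_int v)"
    and "y = of_int n / of_int q + sqrt (of_int v)"
  shows "inverse_periods x y \<longleftrightarrow>
    (\<exists>r c :: int. (r\<^sup>2 - c\<^sup>2 * v = 1 \<or> r\<^sup>2 - c\<^sup>2 * v = -1) \<and>
       gcd c (q\<^sup>2) = q * gcd (m + n) q)"
proof -
  have neg: "- (of_int m / of_int q - sqrt (of_int v)) = - of_int m / of_int q + sqrt (of_int v)"
    by simp
  have gcd_q: "gcd (q * e) (q\<^sup>2) = q * gcd e q" for e
    using assms(2) by (simp add: power2_eq_square gcd_mult_distrib_int[symmetric])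
  have "inverse_periods x y \<longleftrightarrow>
      gl2_equiv (- of_int m / of_int q + sqrt (of_int v)) (of_int n / of_int q + sqrt (of_int v))"
    unfolding assms(6,7)
    using inverse_periods_iff_gl2_equiv[OF conjugates_shifted_sqrt[OF assms(1-3), of m]
        conjugates_shifted_sqrt[OF assms(1-3), of n]]
    unfolding neg .
  also have "\<dots> \<longleftrightarrow> (\<exists>r e :: int. (r\<^sup>2 - (q * e)\<^sup>2 * v = 1 \<or> r\<^sup>2 - (q * e)\<^sup>2 * v = -1) \<and>
       gcd e q = gcd (m + n) q)"
    using gl2_equiv_shifted_sqrt_iff Pell_congruence_iff assms(1-5) by simp
  also have "\<dots> \<longleftrightarrow> (\<exists>r c :: int. (r\<^sup>2 - c\<^sup>2 * v = 1 \<or> r\<^sup>2 - c\<^sup>2 * v = -1) \<and>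
       gcd c (q\<^sup>2) = q * gcd (m + n) q)"
  proof (intro iffI; elim exE conjE)
    fix r e :: int
    assume "r\<^sup>2 - (q * e)\<^sup>2 * v = 1 \<or> r\<^sup>2 - (q * e)\<^sup>2 * v = -1" "gcd e q = gcd (m + n) q"
    then show "\<exists>r c :: int. (r\<^sup>2 - c\<^sup>2 * v = 1 \<or> r\<^sup>2 - c\<^sup>2 * v = -1) \<and>
        gcd c (q\<^sup>2) = q * gcd (m + n) q"
      using gcd_q by metis
  next
    fix r c :: int
    assume *: "r\<^sup>2 - c\<^sup>2 * v = 1 \<or> r\<^sup>2 - c\<^sup>2 * v = -1" "gcd c (q\<^sup>2) = q * gcd (m + n) q"
    then have "q dvd c"
      by (metis dvd_triv_left dvd_trans gcd_dvd1)
    then obtain e where e: "c = q * e"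
      by (rule dvdE)
    then have "gcd e q = gcd (m + n) q"
      using *(2) assms(2) by (simp add: gcd_q)
    then show "\<exists>r e :: int. (r\<^sup>2 - (q * e)\<^sup>2 * v = 1 \<or> r\<^sup>2 - (q * e)\<^sup>2 * v = -1) \<and>
        gcd e q = gcd (m + n) q"
      using *(1) e by blast
  qed
  finally show ?thesis .
qed

end
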